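(* Let $n\ge 3$ be odd, let $k\ge 1$ be an integer, and let $c$ be an integer with $1\le c<\frac{2n(k+1)}{n-3}$ (no upper bound on $c$ when $n=3$). Let $G_{n,k,c}$ be the unicyclic graph consisting of a cycle $C_n$ with vertices $a_1,a_2,\dots,a_n$ (in cyclic order), together with $k$ pendant vertices attached to each of $a_1,\dots,a_{n-1}$ and $k+c$ pendant vertices attached to $a_n$ (so $G_{n,k,c}$ has $p=q=n(k+1)+c$ vertices and edges). Then $G_{n,k,c}$ is super edge-magic total and $$sm(G_{n,k,c})=2n(k+1)+2c+\frac{n+3}{2}.$$
   Context: All graphs are finite, simple and undirected. For a graph $G$ with $p$ vertices and $q$ edges, a super edge-magic total labeling is a bijection $f\colon V(G)\cup E(G)\to\{1,2,\dots,p+q\}$ with $f(V(G))=\{1,\dots,p\}$ such that $f(u)+f(v)+f(uv)$ equals a constant $c(f)$ (the magic constant) for every edge $uv\in E(G)$. $G$ is super edge-magic total if it admits such a labeling, and its super edge-magic total strength $sm(G)$ is the minimum of $c(f)$ over all super edge-magic total labelings $f$ of $G$. *)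

theory Defs
  imports Complex_Main
begin

text \<open>
  An undirected graph is a vertex set together with a set of edges, an edge being the set of its
  two ends.
\<close>

record 'a ugraph =
  verts :: "'a set"
  edges :: "'a set set"

definition fin_simple_graph :: "'a ugraph \<Rightarrow> bool" where
  "fin_simple_graph G \<longleftrightarrow>
     finite (verts G) \<and> edges G \<subseteq> {e. e \<subseteq> verts G \<and> card e = 2}"

text \<open>
  A total labeling is a function on the disjoint sum of vertices (\<open>Inl\<close>) and edges (\<open>Inr\<close>).
  The number \<open>m\<close> is the magic constant; it is determined by \<open>f\<close> as soon as there is an edge.
\<close>

definition super_edge_magic_total_labeling ::
    "'a ugraph \<Rightarrow> ('a + 'a set \<Rightarrow> nat) \<Rightarrow> nat \<Rightarrow> bool" where
  "super_edge_magic_total_labeling G f m \<longleftrightarrow>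
     bij_betw f (verts G <+> edges G) {1..card (verts G) + card (edges G)} \<and>
     f ` Inl ` verts G = {1..card (verts G)} \<and>
     (\<forall>u v. {u, v} \<in> edges G \<longrightarrow> f (Inl u) + f (Inl v) + f (Inr {u, v}) = m)"

definition super_edge_magic_total :: "'a ugraph \<Rightarrow> bool" where
  "super_edge_magic_total G \<longleftrightarrow>
     fin_simple_graph G \<and> (\<exists>f m. super_edge_magic_total_labeling G f m)"

text \<open>Meaningful only if \<open>G\<close> is super edge-magic total.\<close>

definition sm :: "'a ugraph \<Rightarrow> nat" where
  "sm G = (LEAST m. \<exists>f. super_edge_magic_total_labeling G f m)"

text \<open>
  \<open>Cyc i\<close> is the cycle vertex $a_i$, and \<open>Pend i j\<close> is the $j$-th pendant vertex attached to it;
  all indices start at 1.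
\<close>

datatype vertex = Cyc nat | Pend nat nat

definition pendants :: "nat \<Rightarrow> nat \<Rightarrow> nat \<Rightarrow> nat \<Rightarrow> nat" where
  "pendants n k c i = (if i = n then k + c else k)"

definition unicyclic_graph :: "nat \<Rightarrow> nat \<Rightarrow> nat \<Rightarrow> vertex ugraph" where
  "unicyclic_graph n k c =
     \<lparr> verts = {Cyc i |i. i \<in> {1..n}}
            \<union> {Pend i j |i j. i \<in> {1..n} \<and> j \<in> {1..pendants n k c i}},
       edges = {{Cyc i, Cyc (i + 1)} |i. i \<in> {1..<n}} \<union> {{Cyc n, Cyc 1}}
            \<union> {{Cyc i, Pend i j} |i j. i \<in> {1..n} \<and> j \<in> {1..pendants n k c i}} \<rparr>"

lemma sum_pendants:
  assumes "n \<ge> 1"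
  shows "(\<Sum>i=1..n. pendants n k c i) = n * k + c"
proof -
  have "(\<Sum>i=1..n. pendants n k c i) = (\<Sum>i=1..n. k + (if i = n then c else 0))"
    by (rule sum.cong) (auto simp: pendants_def)
  also have "\<dots> = n * k + c"
    using assms by (simp add: sum.distrib)
  finally show ?thesis .
qed

lemma pendant_index_set:
  assumes "n \<ge> 1"
  shows "finite (SIGMA i:{1..n}. {1..pendants n k c i})"
    and "card (SIGMA i:{1..n}. {1..pendants n k c i}) = n * k + c"
  using sum_pendants[OF assms, of k c] by auto

lemma card_verts_unicyclic_graph:
  assumes "n \<ge> 1"
  shows "finite (verts (unicyclic_graph n k c))"
    and "card (verts (unicyclic_graph n k c)) = n * (k + 1) + c"
proof -
  let ?S = "SIGMA i:{1..n}. {1..pendants n k c i}"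
  have eq: "verts (unicyclic_graph n k c) = Cyc ` {1..n} \<union> (\<lambda>(i, j). Pend i j) ` ?S"
    by (auto simp: unicyclic_graph_def)
  show "finite (verts (unicyclic_graph n k c))"
    unfolding eq using pendant_index_set(1)[OF assms] by blast
  have "card (Cyc ` {1..n}) = n"
    by (subst card_image) (auto simp: inj_on_def)
  moreover have "card ((\<lambda>(i, j). Pend i j) ` ?S) = n * k + c"
    by (subst card_image) (use pendant_index_set(2)[OF assms] in \<open>auto simp: inj_on_def\<close>)
  ultimately show "card (verts (unicyclic_graph n k c)) = n * (k + 1) + c"
    unfolding eq using pendant_index_set(1)[OF assms, of k c]
    by (subst card_Un_disjoint) auto
qed

lemma fin_simple_unicyclic_graph:
  assumes "n \<ge> 3"
  shows "fin_simple_graph (unicyclic_graph n k c)"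
  unfolding fin_simple_graph_def
proof (intro conjI subsetI)
  show "finite (verts (unicyclic_graph n k c))"
    using assms by (intro card_verts_unicyclic_graph(1)) simp
next
  fix e assume "e \<in> edges (unicyclic_graph n k c)"
  then consider i where "e = {Cyc i, Cyc (i + 1)}" "1 \<le> i" "i < n"
    | "e = {Cyc n, Cyc 1}"
    | i j where "e = {Cyc i, Pend i j}" "i \<in> {1..n}" "j \<in> {1..pendants n k c i}"
    unfolding unicyclic_graph_def by auto
  then have "e \<subseteq> verts (unicyclic_graph n k c) \<and> card e = 2"
  proof cases
    case 1
    then show ?thesis by (simp add: unicyclic_graph_def)
  next
    case 2
    then show ?thesis using assms by (simp add: unicyclic_graph_def)
  next
    case 3
    then show ?thesis by (simp add: unicyclic_graph_def)
  qed
  then show "e \<in> {e. e \<subseteq> verts (unicyclic_graph n k c) \<and> card e = 2}" by simp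
qed

lemma card_edges_unicyclic_graph:
  assumes "n \<ge> 3"
  shows "card (edges (unicyclic_graph n k c)) = n * (k + 1) + c"
proof -
  let ?S = "SIGMA i:{1..n}. {1..pendants n k c i}"
  let ?A = "(\<lambda>i. {Cyc i, Cyc (i + 1)}) ` {1..<n}"
  let ?B = "(\<lambda>(i, j). {Cyc i, Pend i j}) ` ?S"
  have n1: "n \<ge> 1" using assms by simp
  have B: "(\<lambda>(i, j). g i j) ` ?S = {g i j |i j. i \<in> {1..n} \<and> j \<in> {1..pendants n k c i}}"
    for g :: "nat \<Rightarrow> nat \<Rightarrow> vertex set"
    by fastforce
  have A: "?A = {{Cyc i, Cyc (i + 1)} |i. i \<in> {1..<n}}"
    by blast
  have eq: "edges (unicyclic_graph n k c) = insert {Cyc n, Cyc 1} ?A \<union> ?B"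
    unfolding A B by (simp add: unicyclic_graph_def)
  have "inj_on (\<lambda>i. {Cyc i, Cyc (i + 1)}) {1..<n}"
    unfolding inj_on_def doubleton_eq_iff vertex.inject by (intro ballI impI) linarith
  then have cA: "card ?A = n - 1"
    by (simp only: card_image card_atLeastLessThan)
  have notin: "{Cyc n, Cyc 1} \<notin> ?A"
  proof
    assume "{Cyc n, Cyc 1} \<in> ?A"
    then obtain i where "{Cyc n, Cyc 1} = {Cyc i, Cyc (i + 1)}" by blast
    then show False
      unfolding doubleton_eq_iff vertex.inject using assms by linarith
  qed
  have finA: "finite ?A"
    by (intro finite_imageI finite_atLeastLessThan)
  have C: "card (insert {Cyc n, Cyc 1} ?A) = n"
    unfolding card_insert_disjoint[OF finA notin] cA using n1 by simp
  have "inj_on (\<lambda>(i, j). {Cyc i, Pend i j}) ?S"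
    by (auto simp: inj_on_def doubleton_eq_iff)
  then have D: "card ?B = n * k + c"
    by (simp only: card_image pendant_index_set(2)[OF n1])
  have disj: "insert {Cyc n, Cyc 1} ?A \<inter> ?B = {}"
    by (auto simp: doubleton_eq_iff)
  have fin: "finite (insert {Cyc n, Cyc 1} ?A)" "finite ?B"
    using pendant_index_set(1)[OF n1, of k c] by simp_all
  show ?thesis
    unfolding eq card_Un_disjoint[OF fin disj] C D by simp
qed

end

theory Submission
  imports Defs
begin

text \<open>
  The sums of the two end labels run over \<open>q\<close> consecutive integers, and the magic constant is
  \<open>p + q + s\<close>, where \<open>s\<close> is the least of these sums. For the lower bound, add up all the magic
  equations: each cycle vertex \<open>a\<^sub>i\<close> is counted once more for each of its pendant vertices and once
  more for the cycle, so with \<open>p = q\<close> the total is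
  \<open>p (2p + 1) + (k + 1) \<Sum>\<^sub>i f(a\<^sub>i) + c f(a\<^sub>n)\<close>, and the labels \<open>f(a\<^sub>i)\<close> are distinct and positive. The
  bound on \<open>c\<close> is exactly what makes this force \<open>s \<ge> (n + 3) / 2\<close>.

  The bound is attained by labeling the cycle with \<open>1, \<dots>, n\<close> so that consecutive labels have the
  consecutive sums from \<open>(n + 3) / 2\<close> on and \<open>a\<^sub>n\<close> gets the middle label \<open>(n + 1) / 2\<close>. The \<open>j\<close>-th
  pendant vertex of \<open>a\<^sub>i\<close>, for \<open>j \<le> k\<close>, gets the label of \<open>a\<^bsub>i+1\<^esub>\<close> shifted by \<open>jn\<close>, so that the
  sums of the cycle are repeated with the shift \<open>jn\<close>, and the remaining pendant vertices of \<open>a\<^sub>n\<close> get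
  the remaining labels in order.
\<close>

text \<open>A surjection between finite sets of equal size is injective, so for an explicit labeling
  it suffices to find a preimage of each value.\<close>

lemma bij_betw_if_covers:
  assumes "finite A" and "card A = card B" and "B \<subseteq> f ` A"
  shows "bij_betw f A B"
proof -
  have "card (f ` A) \<le> card B"
    using assms(1,2) card_image_le by metis
  then have "B = f ` A"
    using assms by (intro card_seteq) auto
  then show ?thesis
    using assms(1,2) by (auto simp: bij_betw_def intro: eq_card_imp_inj_on)
qed

text \<open>Inductively, a new maximum \<open>b\<close> exceeds every element of
  \<open>A \<subseteq> {1..<b}\<close>, so it is at least \<open>card A + 1\<close>, the term gained
  on the left.\<close>

lemma sum_upto_card_le:
  fixes A :: "nat set"
  assumes "finite A" and "0 \<notin> A"
  shows "\<Sum>{1..card A} \<le> \<Sum>A"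
  using assms
proof (induction A rule: finite_linorder_max_induct)
  case empty
  then show ?case by simp
next
  case (insert b A)
  have "A \<subseteq> {1..<b}"
    using insert.hyps insert.prems by (metis (no_types, lifting) One_nat_def Suc_leI
        atLeastLessThan_iff insertCI not_gr_zero subsetI)
  then have "card A \<le> b - 1"
    using card_mono[of "{1..<b}" A] by simp
  moreover have "b \<notin> A" "b > 0"
    using insert.hyps insert.prems by auto
  ultimately show ?case
    using insert by simp
qed

subsection \<open>Labelings and sums of end labels\<close>

text \<open>The vertex labels force the edge labels: reflecting consecutive edge sums by
  \<open>x\<close> to \<open>p + q + s - x\<close> gives exactly the labels above
  \<open>p\<close>.\<close>

lemma super_edge_magic_total_labelingI:
  assumes G: "fin_simple_graph G"
    and g: "bij_betw g (verts G) {1..card (verts G)}"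
    and e: "bij_betw (sum g) (edges G) {s..<s + card (edges G)}"
  shows "\<exists>f. super_edge_magic_total_labeling G f (card (verts G) + card (edges G) + s)"
proof -
  let ?p = "card (verts G)" and ?q = "card (edges G)"
  let ?h = "\<lambda>e. ?p + ?q + s - sum g e"
  let ?f = "case_sum g ?h"
  have "bij_betw (\<lambda>x. ?p + ?q + s - x) {s..<s + ?q} {?p + 1..?p + ?q}"
    by (rule bij_betw_byWitness[where f' = "\<lambda>x. ?p + ?q + s - x"]) auto
  from bij_betw_trans[OF e this] have h: "bij_betw ?h (edges G) {?p + 1..?p + ?q}"
    by (simp add: o_def)
  have "bij_betw ?f (Inl ` verts G) {1..?p}"
    using g by (auto simp: bij_betw_def inj_on_def image_image)
  moreover have "bij_betw ?f (Inr ` edges G) {?p + 1..?p + ?q}"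
    using h by (auto simp: bij_betw_def inj_on_def image_image)
  ultimately have "bij_betw ?f (Inl ` verts G \<union> Inr ` edges G) ({1..?p} \<union> {?p + 1..?p + ?q})"
    by (rule bij_betw_combine) auto
  moreover have "{1..?p} \<union> {?p + 1..?p + ?q} = {1..?p + ?q}"
    by auto
  ultimately have "bij_betw ?f (verts G <+> edges G) {1..?p + ?q}"
    by (simp add: Plus_def)
  moreover have "?f ` Inl ` verts G = {1..?p}"
    using g by (simp add: image_image bij_betw_def)
  moreover have "?f (Inl u) + ?f (Inl v) + ?f (Inr {u, v}) = ?p + ?q + s"
    if uv: "{u, v} \<in> edges G" for u v
  proof -
    have "u \<noteq> v"
      using uv G by (auto simp: fin_simple_graph_def)
    moreover have "sum g {u, v} < s + ?q"
      using bij_betwE[OF e] uv by auto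
    ultimately show ?thesis
      by simp
  qed
  ultimately show ?thesis
    unfolding super_edge_magic_total_labeling_def by blast
qed

text \<open>The magic equations are added over all edges; the vertex sum on the left completes the
  edge labels to the sum of all labels.\<close>

lemma magic_constant_double_count:
  assumes G: "fin_simple_graph G" and f: "super_edge_magic_total_labeling G f m"
  shows "card (edges G) * m + (\<Sum>v\<in>verts G. f (Inl v))
    = \<Sum>{1..card (verts G) + card (edges G)} + (\<Sum>e\<in>edges G. \<Sum>v\<in>e. f (Inl v))"
proof -
  have fin: "finite (verts G)" "finite (edges G)"
    using G unfolding fin_simple_graph_def by (auto intro: finite_subset[where B = "Pow (verts G)"])
  have "(\<Sum>v\<in>e. f (Inl v)) + f (Inr e) = m" if e: "e \<in> edges G" for e
  proof -
    have "card e = 2"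
      using G e by (auto simp: fin_simple_graph_def)
    then obtain u v where "e = {u, v}" "u \<noteq> v"
      by (auto simp: card_2_iff)
    then show ?thesis
      using f e by (simp add: super_edge_magic_total_labeling_def)
  qed
  then have "(\<Sum>e\<in>edges G. (\<Sum>v\<in>e. f (Inl v)) + f (Inr e)) = card (edges G) * m"
    by simp
  moreover have "(\<Sum>v\<in>verts G. f (Inl v)) + (\<Sum>e\<in>edges G. f (Inr e))
      = sum f (verts G <+> edges G)"
    using fin by (simp add: sum.Plus)
  moreover have "sum f (verts G <+> edges G) = \<Sum>{1..card (verts G) + card (edges G)}"
    using f sum.reindex_bij_betw[of f _ _ "\<lambda>x. x"]
    by (simp add: super_edge_magic_total_labeling_def)
  ultimately show ?thesis
    by (simp add: sum.distrib)
qed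

subsection \<open>Enumerating the unicyclic graph\<close>

text \<open>Wrapping around at \<open>n\<close> puts the closing edge on a par with the other cycle
  edges.\<close>

definition cyc_succ :: "nat \<Rightarrow> nat \<Rightarrow> nat" where
  "cyc_succ n i = (if i = n then 1 else i + 1)"

lemma bij_betw_cyc_succ: "bij_betw (cyc_succ n) {1..n} {1..n}"
  by (rule bij_betw_byWitness[where f' = "\<lambda>i. if i = 1 then n else i - 1"])
    (auto simp: cyc_succ_def)

abbreviation pendant_indices :: "nat \<Rightarrow> nat \<Rightarrow> nat \<Rightarrow> (nat \<times> nat) set" where
  "pendant_indices n k c \<equiv> SIGMA i:{1..n}. {1..pendants n k c i}"

lemma verts_unicyclic_graph:
  "verts (unicyclic_graph n k c) = Cyc ` {1..n} \<union> (\<lambda>(i, j). Pend i j) ` pendant_indices n k c"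
  by (auto simp: unicyclic_graph_def)

lemma edges_unicyclic_graph:
  assumes "n \<ge> 1"
  shows "edges (unicyclic_graph n k c) = (\<lambda>i. {Cyc i, Cyc (cyc_succ n i)}) ` {1..n}
    \<union> (\<lambda>(i, j). {Cyc i, Pend i j}) ` pendant_indices n k c"
proof -
  have ivl: "{1..n} = insert n {1..<n}"
    using assms by auto
  have last: "cyc_succ n n = 1"
    by (simp add: cyc_succ_def)
  have init: "(\<lambda>i. {Cyc i, Cyc (cyc_succ n i)}) ` {1..<n} = (\<lambda>i. {Cyc i, Cyc (i + 1)}) ` {1..<n}"
    by (rule image_cong) (auto simp: cyc_succ_def)
  have cyc: "(\<lambda>i. {Cyc i, Cyc (cyc_succ n i)}) ` {1..n}
      = {{Cyc i, Cyc (i + 1)} |i. i \<in> {1..<n}} \<union> {{Cyc n, Cyc 1}}"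
    unfolding ivl image_insert last init by blast
  have pend: "(\<lambda>(i, j). {Cyc i, Pend i j}) ` pendant_indices n k c
      = {{Cyc i, Pend i j} |i j. i \<in> {1..n} \<and> j \<in> {1..pendants n k c i}}"
    by fastforce
  show ?thesis
    unfolding cyc pend by (simp add: unicyclic_graph_def)
qed

lemma sum_verts_unicyclic_graph:
  "sum g (verts (unicyclic_graph n k c))
    = (\<Sum>i=1..n. g (Cyc i)) + (\<Sum>(i, j)\<in>pendant_indices n k c. g (Pend i j))"
proof -
  have "inj_on Cyc {1..n}" "inj_on (\<lambda>(i, j). Pend i j) (pendant_indices n k c)"
    by (auto simp: inj_on_def)
  then show ?thesis
    unfolding verts_unicyclic_graph
    by (subst sum.union_disjoint) (auto simp: sum.reindex o_def case_prod_unfold)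
qed

lemma sum_edges_unicyclic_graph:
  assumes "n \<ge> 3"
  shows "sum g (edges (unicyclic_graph n k c)) = (\<Sum>i=1..n. g {Cyc i, Cyc (cyc_succ n i)})
    + (\<Sum>(i, j)\<in>pendant_indices n k c. g {Cyc i, Pend i j})"
proof -
  \<comment> \<open>For \<open>n = 2\<close> the two cycle edges would coincide.\<close>
  have "inj_on (\<lambda>i. {Cyc i, Cyc (cyc_succ n i)}) {1..n}"
    using assms by (auto simp: inj_on_def doubleton_eq_iff cyc_succ_def split: if_splits)
  moreover have "inj_on (\<lambda>(i, j). {Cyc i, Pend i j}) (pendant_indices n k c)"
    by (auto simp: inj_on_def doubleton_eq_iff)
  moreover have "(\<lambda>i. {Cyc i, Cyc (cyc_succ n i)}) ` {1..n}
      \<inter> (\<lambda>(i, j). {Cyc i, Pend i j}) ` pendant_indices n k c = {}"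
    by (auto simp: doubleton_eq_iff)
  moreover have "n \<ge> 1"
    using assms by simp
  ultimately show ?thesis
    unfolding edges_unicyclic_graph[OF \<open>n \<ge> 1\<close>]
    by (subst sum.union_disjoint) (auto simp: sum.reindex o_def case_prod_unfold)
qed

lemma sum_pendant_indices_fst:
  fixes w :: "nat \<Rightarrow> nat"
  assumes "n \<ge> 1"
  shows "(\<Sum>(i, j)\<in>pendant_indices n k c. w i) = k * (\<Sum>i=1..n. w i) + c * w n"
proof -
  have "(\<Sum>(i, j)\<in>pendant_indices n k c. w i) = (\<Sum>i=1..n. pendants n k c i * w i)"
    by (subst sum.Sigma[symmetric]) auto
  also have "\<dots> = (\<Sum>i=1..n. k * w i + (if i = n then c * w i else 0))"
    by (rule sum.cong) (auto simp: pendants_def algebra_simps)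
  finally show ?thesis
    using assms by (simp add: sum.distrib sum_distrib_left)
qed

text \<open>Each vertex counts with its degree: 1 for a pendant vertex, \<open>k + 2\<close> for a
  cycle vertex, and \<open>c\<close> more for \<open>Cyc n\<close>. The vertex sum is split off
  because it cancels in the double count.\<close>

lemma sum_edge_sums_unicyclic_graph:
  fixes g :: "vertex \<Rightarrow> nat"
  assumes "n \<ge> 3"
  shows "(\<Sum>e\<in>edges (unicyclic_graph n k c). sum g e) = sum g (verts (unicyclic_graph n k c))
    + (k + 1) * (\<Sum>i=1..n. g (Cyc i)) + c * g (Cyc n)"
proof -
  let ?C = "\<Sum>i=1..n. g (Cyc i)"
  have "i \<noteq> cyc_succ n i" for i
    using assms by (simp add: cyc_succ_def)
  then have "(\<Sum>i=1..n. sum g {Cyc i, Cyc (cyc_succ n i)}) = ?C + (\<Sum>i=1..n. g (Cyc (cyc_succ n i)))"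
    by (simp add: sum.distrib)
  also have "(\<Sum>i=1..n. g (Cyc (cyc_succ n i))) = ?C"
    using sum.reindex_bij_betw[OF bij_betw_cyc_succ[of n], of "\<lambda>i. g (Cyc i)"] by simp
  finally have cyc: "(\<Sum>i=1..n. sum g {Cyc i, Cyc (cyc_succ n i)}) = ?C + ?C" .
  have "(\<Sum>(i, j)\<in>pendant_indices n k c. sum g {Cyc i, Pend i j})
      = (\<Sum>(i, j)\<in>pendant_indices n k c. g (Cyc i)) + (\<Sum>(i, j)\<in>pendant_indices n k c. g (Pend i j))"
    by (simp add: sum.distrib case_prod_unfold)
  moreover have "(\<Sum>(i, j)\<in>pendant_indices n k c. g (Cyc i)) = k * ?C + c * g (Cyc n)"
    using sum_pendant_indices_fst[of n "\<lambda>i. g (Cyc i)"] assms by simp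
  ultimately show ?thesis
    using cyc by (simp add: sum_edges_unicyclic_graph[OF assms] sum_verts_unicyclic_graph)
qed

subsection \<open>The lower bound\<close>

text \<open>Here \<open>h + 2\<close> is \<open>(n + 3) / 2\<close>. A smaller \<open>m\<close>
  would give \<open>(k + 1) * n * (h + 1) + c \<le> p * h\<close>, that is
  \<open>n * (k + 1) \<le> c * (h - 1)\<close>.\<close>

lemma magic_constant_unicyclic_graph_ge:
  assumes n: "n = 2 * h + 1" "h \<ge> 1"
    and c: "c * (h - 1) < n * (k + 1)"
    and f: "super_edge_magic_total_labeling (unicyclic_graph n k c) f m"
  shows "2 * (n * (k + 1) + c) + h + 2 \<le> m"
proof -
  let ?G = "unicyclic_graph n k c"
  define p where "p = n * (k + 1) + c"
  define w where "w i = f (Inl (Cyc i))" for i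
  have n3: "n \<ge> 3" and G: "fin_simple_graph ?G"
    using n fin_simple_unicyclic_graph by auto
  have cards: "card (verts ?G) = p" "card (edges ?G) = p"
    using n3 card_verts_unicyclic_graph(2) card_edges_unicyclic_graph by (simp_all add: p_def)
  have "\<Sum>{1..p + p} = p * (2 * p + 1)"
    using gauss_sum_from_Suc_0[of "p + p", where 'a = nat] by (simp add: algebra_simps)
  then have total: "p * m = p * (2 * p + 1) + (k + 1) * (\<Sum>i=1..n. w i) + c * w n"
    using magic_constant_double_count[OF G f]
      sum_edge_sums_unicyclic_graph[OF n3, of "\<lambda>v. f (Inl v)"]
    by (simp add: cards w_def)
  have inj: "inj_on w {1..n}"
    using f by (auto simp: super_edge_magic_total_labeling_def bij_betw_def inj_on_def w_def
        verts_unicyclic_graph)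
  have pos: "w i \<ge> 1" if "i \<in> {1..n}" for i
  proof -
    have "w i \<in> f ` Inl ` verts ?G"
      using that by (auto simp: w_def verts_unicyclic_graph)
    then show ?thesis
      using f by (auto simp: super_edge_magic_total_labeling_def)
  qed
  have "\<Sum>{1..card (w ` {1..n})} \<le> \<Sum>(w ` {1..n})"
    by (rule sum_upto_card_le) (use pos in force)+
  then have "\<Sum>{1..n} \<le> (\<Sum>i=1..n. w i)"
    using inj by (simp add: card_image sum.reindex)
  moreover have "\<Sum>{1..n} = n * (h + 1)"
    using gauss_sum_from_Suc_0[of n, where 'a = nat] n by simp
  ultimately have "(k + 1) * (n * (h + 1)) \<le> (k + 1) * (\<Sum>i=1..n. w i)"
    by (metis mult_le_mono2)
  \<comment> \<open>The optimal labeling has \<open>h + 1\<close> in place of this bound 1 on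
    \<open>w n\<close>. The loss \<open>c * h\<close> is less than \<open>p\<close> by the
    hypothesis on \<open>c\<close>, so the integer \<open>m\<close> cannot drop.\<close>
  moreover have "c \<le> c * w n"
    using pos[of n] n by simp
  ultimately have lower: "p * (2 * p + 1) + (k + 1) * (n * (h + 1)) + c \<le> p * m"
    unfolding total by linarith
  show ?thesis
  proof (rule ccontr)
    assume "\<not> ?thesis"
    then have "m \<le> 2 * p + 1 + h"
      by (simp add: p_def)
    then have "p * m \<le> p * (2 * p + 1) + p * h"
      by (metis mult_le_mono2 distrib_left)
    with lower have "(k + 1) * (n * (h + 1)) + c \<le> p * h"
      by simp
    \<comment> \<open>This removes the truncated subtraction in \<open>h - 1\<close>.\<close>
    moreover obtain h' where "h = Suc h'"
      using n(2) by (cases h) auto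
    ultimately show False
      using c by (simp add: p_def algebra_simps)
  qed
qed

subsection \<open>An optimal labeling\<close>

text \<open>Around the cycle the labels read 1, \<open>h + 2\<close>, 2, \<open>h + 3\<close>, ...,
  \<open>2 * h + 1\<close>, \<open>h + 1\<close>.\<close>

definition cyc_label :: "nat \<Rightarrow> nat \<Rightarrow> nat" where
  "cyc_label h i = i div 2 + 1 + (if even i then h else 0)"

text \<open>Each \<open>j \<le> k\<close> fills one block of \<open>2 * h + 1\<close> labels. In the
  graph only pendant vertices of the last cycle vertex have \<open>j > k\<close>.\<close>

fun opt_label :: "nat \<Rightarrow> nat \<Rightarrow> vertex \<Rightarrow> nat" where
  "opt_label h k (Cyc i) = cyc_label h i"
| "opt_label h k (Pend i j) =
    (if j \<le> k then (2 * h + 1) * j + cyc_label h (cyc_succ (2 * h + 1) i)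
     else (2 * h + 1) * (k + 1) + (j - k))"

text \<open>Successive positions have opposite parity, so one offset \<open>h\<close> enters; only
  the closing edge joins two odd positions, with labels \<open>h + 1\<close> and 1.\<close>

lemma cyc_label_add_succ:
  assumes "n = 2 * h + 1"
  shows "cyc_label h i + cyc_label h (cyc_succ n i) = (if i = n then h + 2 else i + h + 2)"
proof (cases "even i")
  case True
  then obtain m where "i = 2 * m" by (elim evenE)
  moreover from this have "i \<noteq> n"
    using assms by presburger
  ultimately show ?thesis
    by (simp add: cyc_label_def cyc_succ_def)
next
  case False
  then obtain m where "i = 2 * m + 1" by (elim oddE)
  then show ?thesis
    using assms by (simp add: cyc_label_def cyc_succ_def)
qed

lemma cyc_label_surj:
  assumes "n = 2 * h + 1" and "x \<in> {1..n}"
  shows "\<exists>i\<in>{1..n}. cyc_label h i = x"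
proof (cases "x \<le> h + 1")
  case True
  have "2 * x - 1 = 2 * (x - 1) + 1" "2 * x - 1 \<in> {1..n}"
    using True assms by auto
  moreover from this have "cyc_label h (2 * x - 1) = x"
    using assms by (simp add: cyc_label_def)
  ultimately show ?thesis by blast
next
  case False
  then have "cyc_label h (2 * (x - h - 1)) = x" "2 * (x - h - 1) \<in> {1..n}"
    using assms by (auto simp: cyc_label_def)
  then show ?thesis by blast
qed

lemma bij_betw_opt_label:
  assumes n: "n = 2 * h + 1"
  shows "bij_betw (opt_label h k) (verts (unicyclic_graph n k c)) {1..n * (k + 1) + c}"
proof (rule bij_betw_if_covers)
  let ?V = "verts (unicyclic_graph n k c)"
  have Cyc: "Cyc i \<in> ?V" if "i \<in> {1..n}" for i
    using that by (simp add: verts_unicyclic_graph)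
  have Pend: "Pend i j \<in> ?V" if "i \<in> {1..n}" "j \<in> {1..pendants n k c i}" for i j
    using that by (force simp: verts_unicyclic_graph)
  show "{1..n * (k + 1) + c} \<subseteq> opt_label h k ` ?V"
  proof
    fix x assume x: "x \<in> {1..n * (k + 1) + c}"
    consider "x \<le> n" | "n < x" "x \<le> n * (k + 1)" | "n * (k + 1) < x"
      by linarith
    then show "x \<in> opt_label h k ` ?V"
    proof cases
      case 1
      then obtain i where "i \<in> {1..n}" "cyc_label h i = x"
        using cyc_label_surj[OF n, of x] x by auto
      then show ?thesis
        using Cyc by (intro image_eqI[of _ _ "Cyc i"]) auto
    next
      case 2
      \<comment> \<open>The shift by 1 makes block \<open>j\<close> run from
        \<open>n * j + 1\<close> to \<open>n * (j + 1)\<close>.\<close>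
      define j where "j = (x - 1) div n"
      have xj: "x = n * j + ((x - 1) mod n + 1)"
        using x by (simp add: j_def)
      have "n > 0"
        using n by simp
      then have "(x - 1) mod n < n"
        by simp
      then have "(x - 1) mod n + 1 \<in> {1..n}"
        unfolding atLeastAtMost_iff by linarith
      then obtain i' where "i' \<in> {1..n}" "cyc_label h i' = (x - 1) mod n + 1"
        using cyc_label_surj[OF n] by blast
      \<comment> \<open>Pendant vertices take the label of the next cycle vertex, so the position
        found is stepped back by one.\<close>
      moreover from this obtain i where "i \<in> {1..n}" "i' = cyc_succ n i"
        using bij_betw_cyc_succ[of n] unfolding bij_betw_def by blast
      moreover have "j < k + 1"
        unfolding j_def using 2 \<open>n > 0\<close> by (intro less_mult_imp_div_less) (simp add: mult.commute)
      moreover have "j \<ge> 1"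
        unfolding j_def using 2 \<open>n > 0\<close> by (simp add: Suc_le_eq div_greater_zero_iff)
      ultimately show ?thesis
        using Pend[of i j] xj n by (intro image_eqI[of _ _ "Pend i j"]) (auto simp: pendants_def)
    next
      case 3
      define t where "t = x - n * (k + 1)"
      have t: "x = n * (k + 1) + t" "t \<in> {1..c}"
        using 3 x by (auto simp: t_def)
      show ?thesis
      proof (rule image_eqI)
        show "x = opt_label h k (Pend n (k + t))"
          using t n by simp
        show "Pend n (k + t) \<in> ?V"
          using t n by (intro Pend) (auto simp: pendants_def)
      qed
    qed
  qed
qed (use n card_verts_unicyclic_graph[of n k c] in simp_all)

text \<open>For \<open>j \<le> k\<close> the \<open>j\<close>-th pendant edges repeat the
  \<open>n\<close> cycle sums shifted by \<open>n * j\<close>; the extra ones at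
  \<open>Cyc n\<close> continue the interval.\<close>

lemma bij_betw_sum_opt_label:
  assumes n: "n = 2 * h + 1" "h \<ge> 1"
  shows "bij_betw (sum (opt_label h k)) (edges (unicyclic_graph n k c))
    {h + 2..<h + 2 + (n * (k + 1) + c)}"
proof (rule bij_betw_if_covers)
  let ?E = "edges (unicyclic_graph n k c)"
  have n3: "n \<ge> 3" and n1: "n \<ge> 1"
    using n by auto
  show "finite ?E"
    using n1 pendant_index_set(1)[OF n1] by (simp add: edges_unicyclic_graph)
  show "card ?E = card {h + 2..<h + 2 + (n * (k + 1) + c)}"
    using card_edges_unicyclic_graph[OF n3] by simp
  have cyc: "{Cyc i, Cyc (cyc_succ n i)} \<in> ?E" if "i \<in> {1..n}" for i
    using that n1 by (simp add: edges_unicyclic_graph)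
  have pend: "{Cyc i, Pend i j} \<in> ?E" if "i \<in> {1..n}" "j \<in> {1..pendants n k c i}" for i j
    using that n1 by (force simp: edges_unicyclic_graph)
  \<comment> \<open>The least sum, \<open>r = 0\<close>, comes from the closing edge
    \<open>i = n\<close>.\<close>
  have sums: "\<exists>i\<in>{1..n}. cyc_label h i + cyc_label h (cyc_succ n i) = h + 2 + r" if "r < n" for r
    using that n1 cyc_label_add_succ[OF n(1), of "if r = 0 then n else r"]
    by (intro bexI[of _ "if r = 0 then n else r"]) auto
  show "{h + 2..<h + 2 + (n * (k + 1) + c)} \<subseteq> sum (opt_label h k) ` ?E"
  proof
    fix y assume y: "y \<in> {h + 2..<h + 2 + (n * (k + 1) + c)}"
    define z where "z = y - (h + 2)"
    have yz: "y = h + 2 + z" and z: "z < n * (k + 1) + c"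
      using y by (auto simp: z_def)
    consider "z < n" | "n \<le> z" "z < n * (k + 1)" | "n * (k + 1) \<le> z"
      by linarith
    then show "y \<in> sum (opt_label h k) ` ?E"
    proof cases
      case 1
      then obtain i where i: "i \<in> {1..n}" "cyc_label h i + cyc_label h (cyc_succ n i) = y"
        using sums yz by blast
      moreover have "i \<noteq> cyc_succ n i"
        using n3 by (simp add: cyc_succ_def)
      ultimately show ?thesis
        using cyc by (intro image_eqI[of _ _ "{Cyc i, Cyc (cyc_succ n i)}"]) auto
    next
      case 2
      define j where "j = z div n"
      obtain i where i: "i \<in> {1..n}" "cyc_label h i + cyc_label h (cyc_succ n i) = h + 2 + z mod n"
        using sums[of "z mod n"] n1 by auto
      have zj: "z = n * j + z mod n"
        by (simp add: j_def)
      have j: "j \<le> k" "j \<ge> 1"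
        using 2 n1 less_mult_imp_div_less[of z "k + 1" n]
        by (auto simp: j_def mult.commute Suc_le_eq div_greater_zero_iff)
      show ?thesis
      proof (rule image_eqI)
        show "y = sum (opt_label h k) {Cyc i, Pend i j}"
          using j(1) i(2) yz zj n by simp
        show "{Cyc i, Pend i j} \<in> ?E"
          using i(1) j by (intro pend) (auto simp: pendants_def)
      qed
    next
      case 3
      \<comment> \<open>The offset \<open>z\<close> counts from 0 but \<open>t\<close> from 1; the
        label \<open>h + 1\<close> of \<open>Cyc n\<close> supplies the missing 1 against
        \<open>h + 2\<close>.\<close>
      define t where "t = z + 1 - n * (k + 1)"
      have t: "z + 1 = n * (k + 1) + t" "t \<in> {1..c}"
        using 3 z by (auto simp: t_def)
      have "cyc_label h n = h + 1"
        using n by (simp add: cyc_label_def)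
      show ?thesis
      proof (rule image_eqI)
        show "y = sum (opt_label h k) {Cyc n, Pend n (k + t)}"
          using t yz n \<open>cyc_label h n = h + 1\<close> by simp
        show "{Cyc n, Pend n (k + t)} \<in> ?E"
          using t n1 by (intro pend) (auto simp: pendants_def)
      qed
    qed
  qed
qed

theorem theorem2p1:
  fixes n k c :: nat
  assumes "n \<ge> 3" and "odd n" and "k \<ge> 1" and "c \<ge> 1"
    and "n \<noteq> 3 \<Longrightarrow> real c < 2 * real n * (real k + 1) / (real n - 3)"
  shows "super_edge_magic_total (unicyclic_graph n k c)
    \<and> real (sm (unicyclic_graph n k c))
        = 2 * real n * (real k + 1) + 2 * real c + (real n + 3) / 2"
proof -
  let ?G = "unicyclic_graph n k c"
  obtain h where n: "n = 2 * h + 1"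
    using assms(2) by (elim oddE)
  have h: "h \<ge> 1"
    using n assms(1) by simp
  \<comment> \<open>Since \<open>h - 1\<close> is \<open>(n - 3) / 2\<close>, this is the bound on
    \<open>c\<close> with the denominator cleared; for \<open>n = 3\<close> the left side is
    0.\<close>
  have c: "c * (h - 1) < n * (k + 1)"
  proof (cases "n = 3")
    case True
    then show ?thesis using n by simp
  next
    case False
    have "h > 1"
      using False n assms(1) by simp
    then have h3: "real n - 3 = 2 * real (h - 1)" "real n - 3 > 0"
      by (simp_all add: n of_nat_diff)
    have "real c * (2 * real (h - 1)) < 2 * real n * (real k + 1)"
      using assms(5)[OF False] h3 by (simp add: pos_less_divide_eq)
    then have "real (c * (h - 1)) < real (n * (k + 1))"
      by (simp only: of_nat_mult of_nat_add of_nat_1 mult.left_commute[of _ 2] mult.assoc)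
    then show ?thesis
      by (simp only: of_nat_less_iff)
  qed
  have G: "fin_simple_graph ?G"
    using fin_simple_unicyclic_graph[OF assms(1)] .
  have cards: "card (verts ?G) = n * (k + 1) + c" "card (edges ?G) = n * (k + 1) + c"
    using assms(1) card_verts_unicyclic_graph(2) card_edges_unicyclic_graph by simp_all
  obtain f where f: "super_edge_magic_total_labeling ?G f (2 * (n * (k + 1) + c) + h + 2)"
    using super_edge_magic_total_labelingI[OF G, of "opt_label h k" "h + 2"]
      bij_betw_opt_label[OF n] bij_betw_sum_opt_label[OF n h]
    by (auto simp only: cards mult_2 add.assoc)
  have "sm ?G = 2 * (n * (k + 1) + c) + h + 2"
    unfolding sm_def using f magic_constant_unicyclic_graph_ge[OF n h c]
    by (intro Least_equality) blast+
  moreover have "super_edge_magic_total ?G"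
    using G f by (auto simp: super_edge_magic_total_def)
  moreover have "(real n + 3) / 2 = real h + 2"
    by (simp add: n)
  ultimately show ?thesis
    by (simp add: algebra_simps)
qed

end
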